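(* Let $\mathcal J$ be a finite set of $m$ regions, let $\mathbf X_a,\mathbf X_b>0$ be the fleet sizes of two players $a$ and $b$, and for each $j\in\mathcal J$ let $\beta^m_j>0$, $\varepsilon_j>0$ and $\beta^c_j\in\mathbb R$. Consider the two-player game $\mathcal G$ in which each player $i\in\{a,b\}$, given the opponent's strategy $x^{-i}$, chooses $x^i\in\Omega_i$ so as to maximize $\mathbf u_i(x^i,x^{-i})$, where $$\Omega_i=\Big\{x^i\in\mathbb R^{\mathcal J}_{\ge 0} : \sum_{j\in\mathcal J}x^i_j=\mathbf X_i\Big\},\qquad \mathbf u_i(x^i,x^{-i})=\sum_{j\in\mathcal J}x^i_j\left(\frac{\beta^m_j}{x^i_j+x^{-i}_j+\varepsilon_j}-\beta^c_j\right).$$ Put $\mathbf\Sigma_\varepsilon=\sum_{j\in\mathcal J}\varepsilon_j$. If an interior Nash equilibrium $\overline x=(\overline x^a,\overline x^b)\in\Omega_a\times\Omega_b$ of $\mathcal G$ exists, i.e. a Nash equilibrium with $\overline x^a_j>0$ and $\overline x^b_j>0$ for all $j\in\mathcal J$, then it is determined, for $i\in\{a,b\}$ and $j\in\mathcal J$, by $$\overline x^i_j=\frac{(\kappa_j^* )^2}{\beta^m_j}\left(\beta^c_j-\overline\lambda^{-i}\right)-\varepsilon_j,$$ $$\overline\lambda^{i}=\frac{1}{\sum_{j\in\mathcal J}\frac{(\kappa_j^* )^2}{\beta^m_j}}\left(-\mathbf\Sigma_\varepsilon-\mathbf X_{-i}+\sum_{j\in\mathcal J}\frac{\beta^c_j(\kappa_j^*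 )^2}{\beta^m_j}\right),$$ where for all $j\in\mathcal J$ $$\kappa_j^*=\frac{\beta^m_j+\sqrt{(\beta^m_j)^2+4\beta^m_j\varepsilon_j(2\beta^c_j-\mathbf t_\lambda^* )}}{2(2\beta^c_j-\mathbf t_\lambda^* )},$$ and where $\mathbf t_\lambda^*$ is the unique solution of the equation (in the unknown $\mathbf t_\lambda$) $$\mathbf X_a+\mathbf X_b+\mathbf\Sigma_\varepsilon=\sum_{j\in\mathcal J}\frac{\beta^m_j+\sqrt{(\beta^m_j)^2+4\beta^m_j\varepsilon_j(2\beta^c_j-\mathbf t_\lambda)}}{2(2\beta^c_j-\mathbf t_\lambda)}$$ satisfying $$\mathbf t_\lambda^*\in\left(-\infty,\ \min_{j\in\mathcal J}\left(\frac{\beta^m_j}{4\varepsilon_j}+2\beta^c_j\right)\right].$$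
   Context: For $i\in\{a,b\}$, $-i$ denotes the other player. A joint strategy $\overline x=(\overline x^a,\overline x^b)\in\Omega_a\times\Omega_b$ is a Nash equilibrium of $\mathcal G$ if for all $i\in\{a,b\}$ and all $x^i\in\Omega_i$ one has $\mathbf u_i(\overline x^i,\overline x^{-i})\ge \mathbf u_i(x^i,\overline x^{-i})$.
   Formalization: The solution t* is required in addition to make every κ_j(t* ) positive, and uniqueness is claimed only among such solutions; without this the equation can have several solutions in the stated interval (e.g. t=0 and t=5 for β^m=(5,9), ε=(1,1), β^c=(15/8,27/8), X_a=X_b=1). *)

theory Defs
  imports "HOL-Analysis.Analysis"
begin

datatype player = Player_a | Player_b

fun opponent :: "player \<Rightarrow> player" where
  "opponent Player_a = Player_b"
| "opponent Player_b = Player_a"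

(* A joint strategy is a function from players to strategies; the first strategy argument of
   the payoff u i is player i's own strategy, the second one is the opponent's. *)
definition nash_equilibrium ::
  "(player \<Rightarrow> 's set) \<Rightarrow> (player \<Rightarrow> 's \<Rightarrow> 's \<Rightarrow> real) \<Rightarrow> (player \<Rightarrow> 's) \<Rightarrow> bool" where
  "nash_equilibrium \<Omega> u x \<longleftrightarrow>
     (\<forall>i. x i \<in> \<Omega> i) \<and>
     (\<forall>i. \<forall>y \<in> \<Omega> i. u i (x i) (x (opponent i)) \<ge> u i y (x (opponent i)))"

(* The regions are the elements of the finite type 'j. *)

definition fleet_strategies :: "(player \<Rightarrow> real) \<Rightarrow> player \<Rightarrow> (real ^ 'j) set" where
  "fleet_strategies X i = {x. (\<forall>j. x $ j \<ge> 0) \<and> (\<Sum>j\<in>UNIV. x $ j) = X i}"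

definition fleet_payoff ::
  "real ^ 'j \<Rightarrow> real ^ 'j \<Rightarrow> real ^ 'j \<Rightarrow> player \<Rightarrow> real ^ 'j \<Rightarrow> real ^ 'j \<Rightarrow> real" where
  "fleet_payoff \<beta>m \<beta>c \<epsilon> i x y =
     (\<Sum>j\<in>UNIV. x $ j * (\<beta>m $ j / (x $ j + y $ j + \<epsilon> $ j) - \<beta>c $ j))"

definition kappa :: "real ^ 'j \<Rightarrow> real ^ 'j \<Rightarrow> real ^ 'j \<Rightarrow> real \<Rightarrow> 'j \<Rightarrow> real" where
  "kappa \<beta>m \<beta>c \<epsilon> t j =
     (\<beta>m $ j + sqrt ((\<beta>m $ j)\<^sup>2 + 4 * \<beta>m $ j * \<epsilon> $ j * (2 * \<beta>c $ j - t)))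
       / (2 * (2 * \<beta>c $ j - t))"

(* The upper bound on t says that all the radicands in kappa are nonnegative.  The equation has
   poles at t = 2 * \<beta>c $ j, where HOL's convention makes the summand 0; beyond a pole the summand
   is negative.  Hence this set may have several elements, and it may contain a pole.  At an
   interior equilibrium kappa is the total load x $ j + y $ j + \<epsilon> $ j of region j, so the relevant
   element is one at which every kappa is positive. *)
definition total_load_solutions ::
  "(player \<Rightarrow> real) \<Rightarrow> real ^ 'j \<Rightarrow> real ^ 'j \<Rightarrow> real ^ 'j \<Rightarrow> real set" where
  "total_load_solutions X \<beta>m \<beta>c \<epsilon> =
     {t. t \<le> Min (range (\<lambda>j. \<beta>m $ j / (4 * \<epsilon> $ j) + 2 * \<beta>c $ j)) \<and>
         X Player_a + X Player_b + (\<Sum>j\<in>UNIV. \<epsilon> $ j) = (\<Sum>j\<in>UNIV. kappa \<beta>m \<beta>c \<epsilon> t j)}"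

definition lambda_bar ::
  "(player \<Rightarrow> real) \<Rightarrow> real ^ 'j \<Rightarrow> real ^ 'j \<Rightarrow> real ^ 'j \<Rightarrow> real \<Rightarrow> player \<Rightarrow> real" where
  "lambda_bar X \<beta>m \<beta>c \<epsilon> t i =
     1 / (\<Sum>j\<in>UNIV. (kappa \<beta>m \<beta>c \<epsilon> t j)\<^sup>2 / \<beta>m $ j) *
     (- (\<Sum>j\<in>UNIV. \<epsilon> $ j) - X (opponent i)
        + (\<Sum>j\<in>UNIV. \<beta>c $ j * (kappa \<beta>m \<beta>c \<epsilon> t j)\<^sup>2 / \<beta>m $ j))"

end

theory Submission
  imports Defs
begin

text \<open>
  At an interior equilibrium the fleet of each player can be shifted slightly between any two
  regions, so the marginal payoff of player \<open>i\<close> takes the same value \<open>- \<mu> i\<close> in all regions.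
  In terms of the total load \<open>k j\<close> of region \<open>j\<close> this reads
  \<open>\<beta>m j * (opponent's load + \<epsilon> j) / (k j)\<^sup>2 = \<beta>c j - \<mu> i\<close>. Adding the equations of both players gives
  the quadratic \<open>(2 * \<beta>c j - t) * (k j)\<^sup>2 = \<beta>m j * (k j + \<epsilon> j)\<close> with \<open>t = \<mu> a + \<mu> b\<close>, whose positive root
  is \<open>kappa\<close>. This root increases strictly with \<open>t\<close>, so the total fleet size determines \<open>t\<close>, and
  summing the equations of a single player over the regions identifies \<open>\<mu>\<close> with
  \<open>lambda_bar\<close>.
\<close>

section \<open>First-order conditions at an interior best response\<close>

text \<open>The partial derivative of \<open>fleet_payoff\<close> in the own load
  \<open>x $ j\<close>; by the quotient rule only the opponent's load and \<open>\<epsilon>\<close>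
  remain in the numerator.\<close>

definition marginal_payoff ::
  "real ^ 'j \<Rightarrow> real ^ 'j \<Rightarrow> real ^ 'j \<Rightarrow> real ^ 'j \<Rightarrow> real ^ 'j \<Rightarrow> 'j \<Rightarrow> real" where
  "marginal_payoff \<beta>m \<beta>c \<epsilon> x y j =
     \<beta>m $ j * (y $ j + \<epsilon> $ j) / (x $ j + y $ j + \<epsilon> $ j)\<^sup>2 - \<beta>c $ j"

lemma has_real_derivative_region_payoff:
  fixes s y e b c :: real
  assumes "s + y + e \<noteq> 0"
  shows "((\<lambda>s. s * (b / (s + y + e) - c)) has_real_derivative
           b * (y + e) / (s + y + e)\<^sup>2 - c) (at s)"
  using assms
  by (auto intro!: derivative_eq_intros simp: field_simps power2_eq_square)

lemma sum_mult_axis: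
  fixes f :: "'j::finite \<Rightarrow> real"
  shows "(\<Sum>l\<in>UNIV. f l * axis j 1 $ l) = f j"
  by (simp add: axis_def if_distrib[of "(*) _"] cong: if_cong)

text \<open>Moving a small amount \<open>h\<close>, of either sign, from region \<open>k\<close> to
  region \<open>j\<close> keeps an interior strategy feasible. Along this line the payoff has a
  local maximum at \<open>h = 0\<close>, where its derivative is the difference of the two marginal
  payoffs.\<close>

lemma marginal_payoff_eq_of_best_response:
  fixes x y \<beta>m \<beta>c \<epsilon> :: "real ^ 'j"
  assumes best: "\<forall>z \<in> fleet_strategies X i. fleet_payoff \<beta>m \<beta>c \<epsilon> i z y \<le> fleet_payoff \<beta>m \<beta>c \<epsilon> i x y"
    and x: "x \<in> fleet_strategies X i" "\<And>j. x $ j > 0"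
    and load: "\<And>j. x $ j + y $ j + \<epsilon> $ j > 0"
  shows "marginal_payoff \<beta>m \<beta>c \<epsilon> x y j = marginal_payoff \<beta>m \<beta>c \<epsilon> x y k"
proof (cases "j = k")
  case jk: False
  define g where "g l s = s * (\<beta>m $ l / (s + y $ l + \<epsilon> $ l) - \<beta>c $ l)" for l s
  define z where "z h = x + h *\<^sub>R (axis j 1 - axis k 1)" for h
  define \<phi> where "\<phi> h = (\<Sum>l\<in>UNIV. g l (z h $ l))" for h
  have payoff: "fleet_payoff \<beta>m \<beta>c \<epsilon> i (z h) y = \<phi> h" for h
    by (simp add: fleet_payoff_def \<phi>_def g_def)
  have z0: "z 0 = x" by (simp add: z_def)
  have z_nth: "z h $ l = x $ l + h * (axis j 1 $ l - axis k 1 $ l)" for h l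
    by (simp add: z_def)
  have dg: "(g l has_real_derivative marginal_payoff \<beta>m \<beta>c \<epsilon> x y l) (at (x $ l))" for l
    unfolding g_def marginal_payoff_def
    using has_real_derivative_region_payoff[of "x $ l" "y $ l" "\<epsilon> $ l"] load[of l] by auto
  have dterm: "((\<lambda>h. g l (z h $ l)) has_real_derivative
      marginal_payoff \<beta>m \<beta>c \<epsilon> x y l * (axis j 1 $ l - axis k 1 $ l)) (at 0)" for l
  proof -
    have "((\<lambda>h. z h $ l) has_real_derivative (axis j 1 $ l - axis k 1 $ l)) (at 0)"
      unfolding z_nth by (auto intro!: derivative_eq_intros)
    moreover have "(g l has_real_derivative marginal_payoff \<beta>m \<beta>c \<epsilon> x y l) (at (z 0 $ l))"
      using dg[of l] by (simp add: z0)
    ultimately show ?thesis by (rule DERIV_chain2[rotated])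
  qed
  have "(\<phi> has_real_derivative
      (\<Sum>l\<in>UNIV. marginal_payoff \<beta>m \<beta>c \<epsilon> x y l * (axis j 1 $ l - axis k 1 $ l))) (at 0)"
    unfolding \<phi>_def by (intro DERIV_sum dterm)
  also have "(\<Sum>l\<in>UNIV. marginal_payoff \<beta>m \<beta>c \<epsilon> x y l * (axis j 1 $ l - axis k 1 $ l))
      = marginal_payoff \<beta>m \<beta>c \<epsilon> x y j - marginal_payoff \<beta>m \<beta>c \<epsilon> x y k"
    by (simp add: right_diff_distrib sum_subtractf sum_mult_axis)
  finally have d\<phi>: "(\<phi> has_real_derivative
      marginal_payoff \<beta>m \<beta>c \<epsilon> x y j - marginal_payoff \<beta>m \<beta>c \<epsilon> x y k) (at 0)" .
  \<comment> \<open>Only the coordinates \<open>j\<close> and \<open>k\<close> change, each by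
    \<open>h\<close>, so this radius keeps them nonnegative.\<close>
  define r where "r = min (x $ j) (x $ k)"
  have "r > 0" using x(2) by (simp add: r_def)
  moreover have "\<phi> h \<le> \<phi> 0" if "\<bar>0 - h\<bar> < r" for h
  proof -
    have "z h $ l \<ge> 0" for l
      using that x(2)[of l] jk by (auto simp: z_nth axis_def r_def)
    moreover have "(\<Sum>l\<in>UNIV. z h $ l) = (\<Sum>l\<in>UNIV. x $ l)"
      by (simp add: z_nth sum.distrib sum_subtractf right_diff_distrib sum_mult_axis)
    ultimately have "z h \<in> fleet_strategies X i"
      using x(1) by (simp add: fleet_strategies_def)
    then show ?thesis
      using best payoff[of h] payoff[of 0] z0 by auto
  qed
  ultimately have "marginal_payoff \<beta>m \<beta>c \<epsilon> x y j - marginal_payoff \<beta>m \<beta>c \<epsilon> x y k = 0"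
    by (intro DERIV_local_max[OF d\<phi>]) auto
  then show ?thesis by simp
qed simp

section \<open>\<open>kappa\<close> as a root of the load quadratic\<close>

lemma kappa_eqI:
  assumes "\<beta>m $ j > 0" "\<epsilon> $ j > 0" "k > 0"
    and quad: "(2 * \<beta>c $ j - t) * k\<^sup>2 = \<beta>m $ j * (k + \<epsilon> $ j)"
  shows "2 * \<beta>c $ j - t > 0" "kappa \<beta>m \<beta>c \<epsilon> t j = k"
proof -
  define D where "D = 2 * \<beta>c $ j - t"
  have "D * k\<^sup>2 > 0"
    using assms unfolding D_def by (metis add_pos_pos mult_pos_pos)
  then have D: "D > 0"
    using \<open>k > 0\<close> by (simp add: zero_less_mult_iff)
  then show "2 * \<beta>c $ j - t > 0"
    by (simp add: D_def)
  have quad': "D * (k * k) = \<beta>m $ j * k + \<beta>m $ j * \<epsilon> $ j"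
    using quad by (simp add: D_def power2_eq_square algebra_simps)
  \<comment> \<open>Completing the square: \<open>quad'\<close> times \<open>4 * D\<close>.\<close>
  have "(\<beta>m $ j)\<^sup>2 + 4 * \<beta>m $ j * \<epsilon> $ j * D = (2 * D * k - \<beta>m $ j)\<^sup>2"
    using quad' unfolding power2_eq_square by algebra
  \<comment> \<open>This sign makes the square root equal to \<open>2 * D * k - \<beta>m $ j\<close>
    rather than its negative.\<close>
  moreover have "2 * D * k - \<beta>m $ j \<ge> 0"
  proof -
    have "\<beta>m $ j * k \<le> (D * k) * k"
      using quad' assms by (simp add: mult.assoc)
    then have "\<beta>m $ j \<le> D * k" using \<open>k > 0\<close> by simp
    then show ?thesis using assms(1) by simp
  qed
  ultimately show "kappa \<beta>m \<beta>c \<epsilon> t j = k"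
    using D unfolding kappa_def D_def[symmetric] by simp
qed

text \<open>The bound on \<open>t\<close> makes the radicand nonnegative, so the root squares back
  to it. This also covers \<open>t\<close> beyond the pole, where
  \<open>2 * \<beta>c $ j - t\<close> is negative.\<close>

lemma kappa_quadratic:
  assumes "\<beta>m $ j > 0" "\<epsilon> $ j > 0" "2 * \<beta>c $ j \<noteq> t"
    and le: "t \<le> \<beta>m $ j / (4 * \<epsilon> $ j) + 2 * \<beta>c $ j"
  shows "(2 * \<beta>c $ j - t) * (kappa \<beta>m \<beta>c \<epsilon> t j)\<^sup>2 = \<beta>m $ j * (kappa \<beta>m \<beta>c \<epsilon> t j + \<epsilon> $ j)"
proof -
  define D where "D = 2 * \<beta>c $ j - t"
  define s where "s = sqrt ((\<beta>m $ j)\<^sup>2 + 4 * \<beta>m $ j * \<epsilon> $ j * D)"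
  define k where "k = kappa \<beta>m \<beta>c \<epsilon> t j"
  have D: "D \<noteq> 0" using assms(3) by (simp add: D_def)
  have "\<beta>m $ j + 4 * \<epsilon> $ j * D \<ge> 0"
    using le assms(2) by (simp add: D_def field_simps)
  then have "\<beta>m $ j * (\<beta>m $ j + 4 * \<epsilon> $ j * D) \<ge> 0"
    using assms(1) by simp
  then have "(\<beta>m $ j)\<^sup>2 + 4 * \<beta>m $ j * \<epsilon> $ j * D \<ge> 0"
    by (simp add: power2_eq_square algebra_simps)
  then have s: "s\<^sup>2 = (\<beta>m $ j)\<^sup>2 + 4 * \<beta>m $ j * \<epsilon> $ j * D"
    unfolding s_def by (rule real_sqrt_pow2)
  have "k = (\<beta>m $ j + s) / (2 * D)"
    by (simp add: k_def kappa_def s_def D_def)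
  then have "s = 2 * D * k - \<beta>m $ j" using D by simp
  with s have "D * (D * k\<^sup>2) = D * (\<beta>m $ j * (k + \<epsilon> $ j))"
    by (simp add: power2_eq_square algebra_simps)
  then have "D * k\<^sup>2 = \<beta>m $ j * (k + \<epsilon> $ j)" using D by simp
  then show ?thesis by (simp only: D_def k_def)
qed

lemma kappa_quadratic_of_solution:
  fixes \<beta>m \<beta>c \<epsilon> :: "real ^ 'j"
  assumes "\<beta>m $ j > 0" "\<epsilon> $ j > 0" "kappa \<beta>m \<beta>c \<epsilon> t j > 0"
    and t: "t \<in> total_load_solutions X \<beta>m \<beta>c \<epsilon>"
  shows "(2 * \<beta>c $ j - t) * (kappa \<beta>m \<beta>c \<epsilon> t j)\<^sup>2 = \<beta>m $ j * (kappa \<beta>m \<beta>c \<epsilon> t j + \<epsilon> $ j)"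
proof (rule kappa_quadratic)
  \<comment> \<open>At the pole, division by zero would give \<open>kappa\<close> the value
    0.\<close>
  show "2 * \<beta>c $ j \<noteq> t" using assms(3) by (auto simp: kappa_def)
  show "t \<le> \<beta>m $ j / (4 * \<epsilon> $ j) + 2 * \<beta>c $ j"
    using t by (auto simp: total_load_solutions_def)
qed (use assms in auto)

section \<open>Monotonicity in \<open>t\<close> and uniqueness\<close>

text \<open>Solved for the coefficient, the quadratic reads
  \<open>D = b * (1 / k + e / k\<^sup>2)\<close>, which decreases in \<open>k > 0\<close>. With
  \<open>D = 2 * \<beta>c $ j - t\<close>, a larger \<open>t\<close> thus means a larger
  load.\<close>

lemma positive_root_strict_mono:
  fixes b e k k' D D' :: real
  assumes "b > 0" "e > 0" "k > 0" "k' > 0"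
    and "D * k\<^sup>2 = b * (k + e)" "D' * k'\<^sup>2 = b * (k' + e)" "D' < D"
  shows "k < k'"
proof (rule ccontr)
  assume "\<not> k < k'"
  then have le: "k' \<le> k" by simp
  have D: "D = b * (1 / k + e / k\<^sup>2)" "D' = b * (1 / k' + e / k'\<^sup>2)"
    using assms by (simp_all add: field_simps power2_eq_square)
  have "1 / k + e / k\<^sup>2 \<le> 1 / k' + e / k'\<^sup>2"
    using le assms by (intro add_mono divide_left_mono power_mono mult_pos_pos) auto
  then have "D \<le> D'" unfolding D using \<open>b > 0\<close> by simp
  with \<open>D' < D\<close> show False by simp
qed

text \<open>A larger \<open>t\<close> would raise every summand \<open>kappa\<close>, but both sums
  equal the same total load.\<close>

lemma positive_solution_not_less:
  fixes \<beta>m \<beta>c \<epsilon> :: "real ^ 'j"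
  assumes "\<And>j. \<beta>m $ j > 0" "\<And>j. \<epsilon> $ j > 0"
    and t: "t \<in> total_load_solutions X \<beta>m \<beta>c \<epsilon>" "\<And>j. kappa \<beta>m \<beta>c \<epsilon> t j > 0"
    and t': "t' \<in> total_load_solutions X \<beta>m \<beta>c \<epsilon>" "\<And>j. kappa \<beta>m \<beta>c \<epsilon> t' j > 0"
  shows "\<not> t < t'"
proof
  assume "t < t'"
  have "kappa \<beta>m \<beta>c \<epsilon> t j < kappa \<beta>m \<beta>c \<epsilon> t' j" for j
    using assms \<open>t < t'\<close>
    by (intro positive_root_strict_mono[OF _ _ _ _
          kappa_quadratic_of_solution[OF _ _ _ t(1)] kappa_quadratic_of_solution[OF _ _ _ t'(1)]])
       auto
  then have "(\<Sum>j\<in>UNIV. kappa \<beta>m \<beta>c \<epsilon> t j) < (\<Sum>j\<in>UNIV. kappa \<beta>m \<beta>c \<epsilon> t' j)"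
    by (intro sum_strict_mono) auto
  then show False
    using t(1) t'(1) by (simp add: total_load_solutions_def)
qed

section \<open>The equilibrium formulas\<close>

theorem theorem2:
  fixes X :: "player \<Rightarrow> real"
    and \<beta>m \<beta>c \<epsilon> :: "real ^ 'j"
    and x :: "player \<Rightarrow> real ^ 'j"
  assumes "\<And>i. X i > 0"
    and "\<And>j. \<beta>m $ j > 0"
    and "\<And>j. \<epsilon> $ j > 0"
    and "nash_equilibrium (fleet_strategies X) (fleet_payoff \<beta>m \<beta>c \<epsilon>) x"
    and "\<And>i j. x i $ j > 0"
  shows "(\<exists>!t. t \<in> total_load_solutions X \<beta>m \<beta>c \<epsilon> \<and> (\<forall>j. kappa \<beta>m \<beta>c \<epsilon> t j > 0)) \<and>
         (\<forall>t. t \<in> total_load_solutions X \<beta>m \<beta>c \<epsilon> \<and> (\<forall>j. kappa \<beta>m \<beta>c \<epsilon> t j > 0) \<longrightarrow>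
            (\<forall>i j. x i $ j =
               (kappa \<beta>m \<beta>c \<epsilon> t j)\<^sup>2 / \<beta>m $ j *
                 (\<beta>c $ j - lambda_bar X \<beta>m \<beta>c \<epsilon> t (opponent i)) - \<epsilon> $ j))"
proof -
  define k where "k j = x Player_a $ j + x Player_b $ j + \<epsilon> $ j" for j
  \<comment> \<open>\<open>undefined\<close> serves as an arbitrary reference region; by
    \<open>marginal\<close> below, any other gives the same multiplier.\<close>
  define \<mu> where "\<mu> i = - marginal_payoff \<beta>m \<beta>c \<epsilon> (x i) (x (opponent i)) undefined" for i
  define t where "t = \<mu> Player_a + \<mu> Player_b"
  have load: "x i $ j + x (opponent i) $ j + \<epsilon> $ j = k j" for i j
    by (cases i) (simp_all add: k_def)
  have k_pos: "k j > 0" for j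
    using assms(3)[of j] assms(5)[of Player_a j] assms(5)[of Player_b j] by (simp add: k_def)
  have feasible: "x i \<in> fleet_strategies X i" for i
    using assms(4) by (simp add: nash_equilibrium_def)
  then have fleet: "(\<Sum>j\<in>UNIV. x i $ j) = X i" for i
    by (simp add: fleet_strategies_def)
  have marginal: "marginal_payoff \<beta>m \<beta>c \<epsilon> (x i) (x (opponent i)) j = - \<mu> i" for i j
  proof -
    have "marginal_payoff \<beta>m \<beta>c \<epsilon> (x i) (x (opponent i)) j
        = marginal_payoff \<beta>m \<beta>c \<epsilon> (x i) (x (opponent i)) undefined"
    proof (rule marginal_payoff_eq_of_best_response)
      show "\<forall>z \<in> fleet_strategies X i. fleet_payoff \<beta>m \<beta>c \<epsilon> i z (x (opponent i))
          \<le> fleet_payoff \<beta>m \<beta>c \<epsilon> i (x i) (x (opponent i))"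
        using assms(4) by (simp add: nash_equilibrium_def)
    qed (use feasible assms(5) load k_pos in auto)
    then show ?thesis by (simp add: \<mu>_def)
  qed
  \<comment> \<open>The condition of player \<open>i\<close> determines the opponent's load, hence
    the multiplier of the other player in \<open>strategy\<close>.\<close>
  have opp: "x (opponent i) $ j + \<epsilon> $ j = (k j)\<^sup>2 / \<beta>m $ j * (\<beta>c $ j - \<mu> i)" for i j
  proof -
    have "\<beta>m $ j * (x (opponent i) $ j + \<epsilon> $ j) / (k j)\<^sup>2 = \<beta>c $ j - \<mu> i"
      using marginal[of i j] by (simp only: marginal_payoff_def load)
    then show ?thesis
      using k_pos[of j] assms(2)[of j] by (simp add: field_simps)
  qed
  have strategy: "x i $ j = (k j)\<^sup>2 / \<beta>m $ j * (\<beta>c $ j - \<mu> (opponent i)) - \<epsilon> $ j" for i j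
    using opp[of "opponent i" j] by (cases i) simp_all
  have quad: "(2 * \<beta>c $ j - t) * (k j)\<^sup>2 = \<beta>m $ j * (k j + \<epsilon> $ j)" for j
  proof -
    have "k j + \<epsilon> $ j = (x (opponent Player_a) $ j + \<epsilon> $ j) + (x (opponent Player_b) $ j + \<epsilon> $ j)"
      by (simp add: k_def)
    then have "\<beta>m $ j * (k j + \<epsilon> $ j)
        = \<beta>m $ j * (x (opponent Player_a) $ j + \<epsilon> $ j) + \<beta>m $ j * (x (opponent Player_b) $ j + \<epsilon> $ j)"
      by (simp only: distrib_left)
    also have "\<dots> = (k j)\<^sup>2 * (\<beta>c $ j - \<mu> Player_a) + (k j)\<^sup>2 * (\<beta>c $ j - \<mu> Player_b)"
      unfolding opp using assms(2)[of j] by simp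
    finally show ?thesis by (simp add: t_def algebra_simps)
  qed
  have D_pos: "2 * \<beta>c $ j - t > 0" and kappa: "kappa \<beta>m \<beta>c \<epsilon> t j = k j" for j
    using kappa_eqI[OF assms(2) assms(3) k_pos quad] by auto
  \<comment> \<open>By \<open>D_pos\<close>, \<open>t\<close> lies to the left of every pole, and
    the required bound lies to the right of one.\<close>
  have "t \<le> \<beta>m $ j / (4 * \<epsilon> $ j) + 2 * \<beta>c $ j" for j
  proof -
    have "0 < \<beta>m $ j / (4 * \<epsilon> $ j)" using assms(2,3)[of j] by simp
    then show ?thesis using D_pos[of j] by linarith
  qed
  moreover have "X Player_a + X Player_b + (\<Sum>j\<in>UNIV. \<epsilon> $ j) = (\<Sum>j\<in>UNIV. k j)"
    by (simp add: k_def sum.distrib fleet)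
  ultimately have t: "t \<in> total_load_solutions X \<beta>m \<beta>c \<epsilon>"
    by (simp add: total_load_solutions_def kappa)
  \<comment> \<open>Positivity excludes solutions at or beyond a pole, where some
    \<open>kappa\<close> is zero or negative.\<close>
  have unique: "t' = t"
    if "t' \<in> total_load_solutions X \<beta>m \<beta>c \<epsilon>" "\<forall>j. kappa \<beta>m \<beta>c \<epsilon> t' j > 0" for t'
  proof (rule antisym)
    show "t' \<le> t"
      using positive_solution_not_less[OF assms(2,3) t _ that(1)] that(2) k_pos
      by (simp add: kappa not_less)
    show "t \<le> t'"
      using positive_solution_not_less[OF assms(2,3) that(1) _ t] that(2) k_pos
      by (simp add: kappa not_less)
  qed
  have lambda: "lambda_bar X \<beta>m \<beta>c \<epsilon> t i = \<mu> i" for i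
  proof -
    have "(\<Sum>j\<in>UNIV. (k j)\<^sup>2 / \<beta>m $ j) > 0"
      by (intro sum_pos divide_pos_pos zero_less_power k_pos assms(2)) auto
    \<comment> \<open>Summing \<open>opp\<close> over all regions leaves one linear equation for
      \<open>\<mu> i\<close>, with a positive coefficient.\<close>
    moreover have "X (opponent i) + (\<Sum>j\<in>UNIV. \<epsilon> $ j)
        = (\<Sum>j\<in>UNIV. \<beta>c $ j * (k j)\<^sup>2 / \<beta>m $ j) - \<mu> i * (\<Sum>j\<in>UNIV. (k j)\<^sup>2 / \<beta>m $ j)"
    proof -
      have "X (opponent i) + (\<Sum>j\<in>UNIV. \<epsilon> $ j) = (\<Sum>j\<in>UNIV. x (opponent i) $ j + \<epsilon> $ j)"
        by (simp add: sum.distrib fleet)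
      also have "\<dots> = (\<Sum>j\<in>UNIV. \<beta>c $ j * (k j)\<^sup>2 / \<beta>m $ j - \<mu> i * ((k j)\<^sup>2 / \<beta>m $ j))"
        unfolding opp by (simp add: algebra_simps diff_divide_distrib)
      finally show ?thesis by (simp add: sum_subtractf sum_distrib_left)
    qed
    moreover have "1 / S * (- E - Y + B) = \<mu> i" if "S > 0" "Y + E = B - \<mu> i * S" for S E Y B :: real
    proof -
      have "- E - Y + B = \<mu> i * S" using that(2) by simp
      then show ?thesis using that(1) by simp
    qed
    ultimately show ?thesis
      unfolding lambda_bar_def kappa by blast
  qed
  show ?thesis
  proof (intro conjI allI impI)
    show "\<exists>!t. t \<in> total_load_solutions X \<beta>m \<beta>c \<epsilon> \<and> (\<forall>j. kappa \<beta>m \<beta>c \<epsilon> t j > 0)"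
    proof (rule ex1I[of _ t])
      show "t \<in> total_load_solutions X \<beta>m \<beta>c \<epsilon> \<and> (\<forall>j. kappa \<beta>m \<beta>c \<epsilon> t j > 0)"
        using t k_pos by (simp add: kappa)
    qed (use unique in blast)
    fix t' i j
    assume "t' \<in> total_load_solutions X \<beta>m \<beta>c \<epsilon> \<and> (\<forall>j. kappa \<beta>m \<beta>c \<epsilon> t' j > 0)"
    then have "t' = t" using unique by blast
    then show "x i $ j = (kappa \<beta>m \<beta>c \<epsilon> t' j)\<^sup>2 / \<beta>m $ j *
        (\<beta>c $ j - lambda_bar X \<beta>m \<beta>c \<epsilon> t' (opponent i)) - \<epsilon> $ j"
      using strategy[of i j] by (simp add: kappa lambda)
  qed
qed

end
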